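(* Let $X$ be a non-empty locally compact metrizable topological space, with a fixed compatible metric $d$, and let $\mathcal F=\{f_1,\dots,f_m\}$ be an iterated function system on $X$. Then $\mathcal F$ has compact dynamics if and only if $\mathcal F$ has a compact global trapping region $Q\subset X$.
   Context: An iterated function system (IFS) on $X$ is a finite collection $\mathcal F=\{f_1,\dots,f_m\}$, $m\ge 1$, of continuous maps $f_i:X\to X$. For a finite word $I=i_1\dots i_k$ ($k\ge 0$) in the alphabet $\{1,\dots,m\}$, $|I|=k$ denotes its length and $\Phi^I_{\mathcal F}=f_{i_1}\circ\dots\circ f_{i_k}$ (the identity map for the empty word). Put $H_{\mathcal F}(A)=\bigcup_{i=1}^m f_i(A)$ for $A\subset X$. A set $A$ is forward-invariant if $f_i(A)\subset A$ for every $i$, and $H$-invariant if $H_{\mathcal F}(A)=A$. $A$ absorbs $K\subset X$ if there is $\tau>0$ such that $\Phi^I_{\mathcal F}(K)\subset A$ for every word $I$ with $|I|\ge\tau$. With $N_\varepsilon(A)=\{x\in X: d(x,A)<\varepsilon\}$, $A$ attracts $K$ if for every $\varepsilon>0$ there is $\tau>0$ such that $\Phi^I_{\mathcal F}(K)\subset N_\varepsilon(A)$ for every word $I$ with $|I|\ge\tau$. A global attractor of $\mathcal F$ is a non-empty compact $H$-invariant set $\mathcal G\subset X$ that attracts every compact subset of $X$. $\mathcal F$ has compact dynamics if it has a global attractor. A trapping region for $\mathcal F$ is a closed forward-invariant subset $Q\subset X$; it is global if it absorbs every compact subset of $X$. *)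

theory Defs
  imports "HOL-Analysis.Analysis"
begin

(* An IFS {f_1, ..., f_m} is given by m and a family f, of which only f 1, ..., f m
   are relevant; the space X is the whole type 'a. *)
definition ifs :: "nat \<Rightarrow> (nat \<Rightarrow> 'a::topological_space \<Rightarrow> 'a) \<Rightarrow> bool" where
  "ifs m f \<longleftrightarrow> m \<ge> 1 \<and> (\<forall>i\<in>{1..m}. continuous_on UNIV (f i))"

abbreviation words :: "nat \<Rightarrow> nat list set" where
  "words m \<equiv> lists {1..m}"

primrec word_map :: "(nat \<Rightarrow> 'a \<Rightarrow> 'a) \<Rightarrow> nat list \<Rightarrow> 'a \<Rightarrow> 'a" where
  "word_map f [] = id"
| "word_map f (i # I) = f i \<circ> word_map f I"

definition hutchinson :: "nat \<Rightarrow> (nat \<Rightarrow> 'a \<Rightarrow> 'a) \<Rightarrow> 'a set \<Rightarrow> 'a set" where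
  "hutchinson m f A = (\<Union>i\<in>{1..m}. f i ` A)"

definition forward_invariant :: "nat \<Rightarrow> (nat \<Rightarrow> 'a \<Rightarrow> 'a) \<Rightarrow> 'a set \<Rightarrow> bool" where
  "forward_invariant m f A \<longleftrightarrow> (\<forall>i\<in>{1..m}. f i ` A \<subseteq> A)"

definition H_invariant :: "nat \<Rightarrow> (nat \<Rightarrow> 'a \<Rightarrow> 'a) \<Rightarrow> 'a set \<Rightarrow> bool" where
  "H_invariant m f A \<longleftrightarrow> hutchinson m f A = A"

definition absorbs :: "nat \<Rightarrow> (nat \<Rightarrow> 'a \<Rightarrow> 'a) \<Rightarrow> 'a set \<Rightarrow> 'a set \<Rightarrow> bool" where
  "absorbs m f A K \<longleftrightarrow>
     (\<exists>\<tau>::nat. \<tau> > 0 \<and> (\<forall>I\<in>words m. length I \<ge> \<tau> \<longrightarrow> word_map f I ` K \<subseteq> A))"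

(* infdist x {} = 0 in the library, whereas d(x, {}) is infinite by convention;
   the conjunct A \<noteq> {} restores the latter. *)
definition nbhd :: "real \<Rightarrow> 'a::metric_space set \<Rightarrow> 'a set" where
  "nbhd \<epsilon> A = {x. A \<noteq> {} \<and> infdist x A < \<epsilon>}"

definition attracts :: "nat \<Rightarrow> (nat \<Rightarrow> 'a::metric_space \<Rightarrow> 'a) \<Rightarrow> 'a set \<Rightarrow> 'a set \<Rightarrow> bool" where
  "attracts m f A K \<longleftrightarrow>
     (\<forall>\<epsilon>>0. \<exists>\<tau>::nat. \<tau> > 0 \<and>
        (\<forall>I\<in>words m. length I \<ge> \<tau> \<longrightarrow> word_map f I ` K \<subseteq> nbhd \<epsilon> A))"

definition global_attractor :: "nat \<Rightarrow> (nat \<Rightarrow> 'a::metric_space \<Rightarrow> 'a) \<Rightarrow> 'a set \<Rightarrow> bool" where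
  "global_attractor m f G \<longleftrightarrow>
     G \<noteq> {} \<and> compact G \<and> H_invariant m f G \<and> (\<forall>K. compact K \<longrightarrow> attracts m f G K)"

definition compact_dynamics :: "nat \<Rightarrow> (nat \<Rightarrow> 'a::metric_space \<Rightarrow> 'a) \<Rightarrow> bool" where
  "compact_dynamics m f \<longleftrightarrow> (\<exists>G. global_attractor m f G)"

definition trapping_region :: "nat \<Rightarrow> (nat \<Rightarrow> 'a::topological_space \<Rightarrow> 'a) \<Rightarrow> 'a set \<Rightarrow> bool" where
  "trapping_region m f Q \<longleftrightarrow> closed Q \<and> forward_invariant m f Q"

definition global_trapping_region ::
    "nat \<Rightarrow> (nat \<Rightarrow> 'a::topological_space \<Rightarrow> 'a) \<Rightarrow> 'a set \<Rightarrow> bool" where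
  "global_trapping_region m f Q \<longleftrightarrow>
     trapping_region m f Q \<and> (\<forall>K. compact K \<longrightarrow> absorbs m f Q K)"

end

theory Submission
  imports Defs
begin

text \<open>
  Grouping words by their length, the sets \<open>\<Phi>\<^sup>I(A)\<close> with \<open>|I| = n\<close> have union \<open>H\<^sup>n(A)\<close>
  (\<open>iterate_hutchinson\<close>), so absorption and attraction can be expressed by the iterates of the
  Hutchinson operator \<open>H\<close>, which preserves compactness because the system is finite.

  From an attractor \<open>G\<close> to a trapping region: local compactness gives a compact neighbourhood \<open>V\<close>
  of \<open>G\<close>, and by compactness of \<open>G\<close> it contains a metric neighbourhood \<open>N\<^sub>\<epsilon>(G)\<close>. Since \<open>G\<close>
  attracts compact sets, \<open>V\<close> absorbs them; in particular it absorbs itself, that is,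
  \<open>H\<^sup>n(V) \<subseteq> V\<close> for all \<open>n \<ge> \<tau>\<close>. The set \<open>V\<close> need not be forward-invariant, but the finite
  union \<open>V \<union> H(V) \<union> \<dots> \<union> H\<^sup>\<tau>\<^sup>-\<^sup>1(V)\<close> is compact and forward-invariant, and it absorbs whatever
  \<open>V\<close> absorbs.

  From a trapping region \<open>Q\<close> to an attractor: the iterates \<open>H\<^sup>n(Q)\<close> form a decreasing sequence of
  non-empty compact sets, and \<open>G = \<Inter>\<^sub>n H\<^sup>n(Q)\<close> is the attractor. The tool is that a decreasing
  sequence of compact sets eventually enters every open neighbourhood of its intersection
  (\<open>decreasing_compact_eventually_subset\<close>). Applied to the empty set it shows \<open>G \<noteq> {}\<close>, applied
  to \<open>N\<^sub>\<epsilon>(G)\<close> it shows attraction, and applied to the open set of points that no \<open>f\<^sub>i\<close> maps to a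
  given point outside \<open>H(G)\<close> it shows \<open>G \<subseteq> H(G)\<close>.
\<close>

section \<open>Compact sets and their neighbourhoods\<close>

text \<open>
  The open sets \<open>U \<union> - C n\<close> cover \<open>C 0\<close>, and a finite subfamily already does; the largest index
  occurring in it works.
\<close>

lemma decreasing_compact_eventually_subset:
  fixes C :: "nat \<Rightarrow> 'a::t2_space set"
  assumes "\<And>n. compact (C n)" and "decseq C" and "open U" and "(\<Inter>n. C n) \<subseteq> U"
  shows "\<exists>n. C n \<subseteq> U"
proof -
  have "\<And>n. open (U \<union> - C n)"
    using assms(1,3) by (auto intro: compact_imp_closed)
  moreover have "C 0 \<subseteq> (\<Union>n\<in>UNIV. U \<union> - C n)"
    using assms(4) by blast
  ultimately obtain N where N: "finite N" "C 0 \<subseteq> (\<Union>n\<in>N. U \<union> - C n)"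
    using compactE_image[OF assms(1)[of 0], of UNIV "\<lambda>n. U \<union> - C n"] by (metis (lifting))
  obtain M where M: "\<forall>n\<in>N. n \<le> M"
    using N(1) finite_nat_set_iff_bounded_le by auto
  have "C M \<subseteq> U"
  proof
    fix x assume "x \<in> C M"
    then have "x \<in> C 0" and "\<And>n. n \<in> N \<Longrightarrow> x \<in> C n"
      using M decseqD[OF assms(2), of _ M] by blast+
    then show "x \<in> U" using N(2) by blast
  qed
  then show ?thesis ..
qed

lemma open_nbhd: "open (nbhd \<epsilon> A)"
proof (cases "A = {}")
  case False
  then have "nbhd \<epsilon> A = {x. infdist x A < \<epsilon>}"
    by (simp add: nbhd_def)
  then show ?thesis
    by (simp add: open_Collect_less continuous_intros)
qed (simp add: nbhd_def)

lemma subset_nbhd: "\<epsilon> > 0 \<Longrightarrow> A \<subseteq> nbhd \<epsilon> A"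
  by (auto simp: nbhd_def)

lemma compact_subset_open_imp_nbhd_subset:
  assumes "compact A" and "open U" and "A \<subseteq> U"
  obtains \<epsilon> where "\<epsilon> > 0" and "nbhd \<epsilon> A \<subseteq> U"
proof -
  obtain \<epsilon> where \<epsilon>: "\<epsilon> > 0" "(\<Union>x\<in>A. ball x \<epsilon>) \<subseteq> U"
    using compact_subset_open_imp_ball_epsilon_subset[OF assms] .
  have "nbhd \<epsilon> A \<subseteq> (\<Union>x\<in>A. ball x \<epsilon>)"
  proof
    fix x assume "x \<in> nbhd \<epsilon> A"
    then have "A \<noteq> {}" "infdist x A < \<epsilon>" by (auto simp: nbhd_def)
    then obtain a where "a \<in> A" "dist x a < \<epsilon>"
      using cINF_greatest[of A \<epsilon> "dist x"] by (auto simp: infdist_notempty not_less[symmetric])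
    then show "x \<in> (\<Union>x\<in>A. ball x \<epsilon>)" by (auto simp: dist_commute)
  qed
  then show thesis using that[OF \<epsilon>(1)] \<epsilon>(2) by (meson order_trans)
qed

section \<open>Iterates of the Hutchinson operator\<close>

text \<open>
  The first letter of a word is the map applied last, so prepending letters to words of length
  \<open>n\<close> matches one more application of \<open>H\<close> from outside.
\<close>

lemma iterate_hutchinson:
  "(hutchinson m f ^^ n) A = (\<Union>I\<in>{I \<in> words m. length I = n}. word_map f I ` A)"
proof (induction n)
  case 0
  have "{I \<in> words m. length I = 0} = {[]}" by auto
  then show ?case by simp
next
  case (Suc n)
  have "{I \<in> words m. length I = Suc n} =
      (\<Union>i\<in>{1..m}. (#) i ` {I \<in> words m. length I = n})"
    by (fastforce simp: length_Suc_conv)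
  moreover have "(hutchinson m f ^^ Suc n) A =
      (\<Union>i\<in>{1..m}. \<Union>I\<in>{I \<in> words m. length I = n}. word_map f (i # I) ` A)"
    by (simp only: funpow.simps comp_apply Suc.IH hutchinson_def image_UN image_comp word_map.simps)
  ultimately show ?case by (simp only: UN_UN_flatten image_image UN_extend_simps)
qed

lemma word_map_image_subset_iterate:
  "I \<in> words m \<Longrightarrow> word_map f I ` A \<subseteq> (hutchinson m f ^^ length I) A"
  unfolding iterate_hutchinson by (intro UN_upper) simp

lemma absorbs_imp_iterate_subset:
  assumes "absorbs m f A K"
  shows "\<exists>\<tau>>0. \<forall>n\<ge>\<tau>. (hutchinson m f ^^ n) K \<subseteq> A"
proof -
  obtain \<tau> where "\<tau> > 0" and \<tau>: "\<And>I. I \<in> words m \<Longrightarrow> length I \<ge> \<tau> \<Longrightarrow> word_map f I ` K \<subseteq> A"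
    using assms unfolding absorbs_def by auto
  have "(hutchinson m f ^^ n) K \<subseteq> A" if "n \<ge> \<tau>" for n
    unfolding iterate_hutchinson using \<tau> that by (intro UN_least) simp
  with \<open>\<tau> > 0\<close> show ?thesis by auto
qed

lemma absorbs_mono: "absorbs m f A K \<Longrightarrow> A \<subseteq> B \<Longrightarrow> absorbs m f B K"
  unfolding absorbs_def by (blast intro: order_trans)

lemma forward_invariant_iff: "forward_invariant m f A \<longleftrightarrow> hutchinson m f A \<subseteq> A"
  by (simp add: forward_invariant_def hutchinson_def UN_subset_iff)

lemma mono_hutchinson: "mono (hutchinson m f)"
  unfolding hutchinson_def by (intro monoI UN_mono image_mono) auto

lemma compact_iterate_hutchinson:
  assumes "ifs m f" and "compact A"
  shows "compact ((hutchinson m f ^^ n) A)"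
proof (induction n)
  case (Suc n)
  have "compact (f i ` (hutchinson m f ^^ n) A)" if "i \<in> {1..m}" for i
    using assms(1) that Suc.IH unfolding ifs_def
    by (meson compact_continuous_image continuous_on_subset subset_UNIV)
  then have "compact (hutchinson m f ((hutchinson m f ^^ n) A))"
    unfolding hutchinson_def by (intro compact_UN) auto
  then show ?case by simp
qed (simp add: assms)

lemma iterate_hutchinson_nonempty:
  assumes "ifs m f" and "A \<noteq> {}"
  shows "(hutchinson m f ^^ n) A \<noteq> {}"
proof (induction n)
  case (Suc n)
  have "1 \<in> {1..m}" using assms(1) by (simp add: ifs_def)
  with Suc.IH show ?case by (auto simp: hutchinson_def)
qed (simp add: assms)

lemma decseq_iterate_hutchinson:
  assumes "forward_invariant m f A"
  shows "decseq (\<lambda>n. (hutchinson m f ^^ n) A)"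
proof (rule decseq_SucI)
  fix n
  have "(hutchinson m f ^^ n) (hutchinson m f A) \<subseteq> (hutchinson m f ^^ n) A"
    using mono_hutchinson assms monoD[OF mono_pow] unfolding forward_invariant_iff by blast
  then show "(hutchinson m f ^^ Suc n) A \<subseteq> (hutchinson m f ^^ n) A"
    by (simp add: funpow_swap1)
qed

section \<open>From an attractor to a trapping region\<close>

text \<open>
  \<open>H\<close> shifts the union by one step: every iterate goes to the next one, and the last goes to
  \<open>H\<^sup>\<tau>(V)\<close>, which is back inside the term \<open>V\<close> for \<open>n = 0\<close>.
\<close>

lemma finite_union_of_iterates_forward_invariant:
  assumes "\<tau> > 0" and "(hutchinson m f ^^ \<tau>) V \<subseteq> V"
  shows "forward_invariant m f (\<Union>n<\<tau>. (hutchinson m f ^^ n) V)" (is "forward_invariant m f ?Q")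
proof -
  have "(hutchinson m f ^^ Suc n) V \<subseteq> ?Q" if "n < \<tau>" for n
  proof (cases "Suc n < \<tau>")
    case False
    with that have "Suc n = \<tau>" by simp
    then have "(hutchinson m f ^^ Suc n) V \<subseteq> (hutchinson m f ^^ 0) V"
      using assms(2) by simp
    then show ?thesis using assms(1) by blast
  qed blast
  moreover have "hutchinson m f ?Q = (\<Union>n<\<tau>. (hutchinson m f ^^ Suc n) V)"
    by (auto simp: hutchinson_def)
  ultimately show ?thesis
    unfolding forward_invariant_iff by blast
qed

lemma global_attractor_imp_trapping_region:
  fixes f :: "nat \<Rightarrow> 'a::metric_space \<Rightarrow> 'a"
  assumes "locally_compact_space (euclidean :: 'a topology)" and "ifs m f"
    and "global_attractor m f G"
  shows "\<exists>Q. compact Q \<and> global_trapping_region m f Q"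
proof -
  have "compact G" using assms(3) by (simp add: global_attractor_def)
  then obtain U V where UV: "open U" "compact V" "G \<subseteq> U" "U \<subseteq> V"
    using assms(1) locally_compact_space_compact_closed_compact[of "euclidean :: 'a topology"]
    by (auto simp: Hausdorff_space_euclidean)
  obtain \<epsilon> where "\<epsilon> > 0" "nbhd \<epsilon> G \<subseteq> U"
    using compact_subset_open_imp_nbhd_subset[OF \<open>compact G\<close> UV(1,3)] .
  then have "nbhd \<epsilon> G \<subseteq> V" using UV(4) by blast
  have V_absorbs: "absorbs m f V K" if "compact K" for K
  proof -
    have "absorbs m f (nbhd \<epsilon> G) K"
      using assms(3) that \<open>\<epsilon> > 0\<close>
      unfolding global_attractor_def attracts_def absorbs_def by blast
    then show ?thesis using \<open>nbhd \<epsilon> G \<subseteq> V\<close> by (rule absorbs_mono)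
  qed
  obtain \<tau> where \<tau>: "\<tau> > 0" "\<forall>n\<ge>\<tau>. (hutchinson m f ^^ n) V \<subseteq> V"
    using absorbs_imp_iterate_subset[OF V_absorbs[OF \<open>compact V\<close>]] by (elim exE conjE)
  define Q where "Q = (\<Union>n<\<tau>. (hutchinson m f ^^ n) V)"
  have "compact Q"
    unfolding Q_def using compact_iterate_hutchinson[OF assms(2) \<open>compact V\<close>]
    by (intro compact_UN) auto
  moreover have "forward_invariant m f Q"
    unfolding Q_def using \<tau> by (intro finite_union_of_iterates_forward_invariant) auto
  moreover have "V \<subseteq> Q"
    unfolding Q_def using \<tau>(1) by (metis UN_upper funpow_0 lessThan_iff)
  then have "absorbs m f Q K" if "compact K" for K
    using absorbs_mono[OF V_absorbs[OF that]] by blast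
  ultimately show ?thesis
    unfolding global_trapping_region_def trapping_region_def
    using compact_imp_closed by blast
qed

section \<open>From a trapping region to an attractor\<close>

text \<open>
  As \<open>m \<ge> 1\<close>, there are words of every length, so absorbing a non-empty set is not a vacuous
  condition.
\<close>

lemma absorbing_set_nonempty:
  assumes "ifs m f" and "absorbs m f Q K" and "K \<noteq> {}"
  shows "Q \<noteq> {}"
proof -
  obtain \<tau> where "(hutchinson m f ^^ \<tau>) K \<subseteq> Q"
    using absorbs_imp_iterate_subset[OF assms(2)] by (metis order_refl)
  then show ?thesis using iterate_hutchinson_nonempty[OF assms(1,3)] by (metis subset_empty)
qed

text \<open>
  The inclusion \<open>\<Inter>\<^sub>n H\<^sup>n(Q) \<subseteq> H(\<Inter>\<^sub>n H\<^sup>n(Q))\<close> rests on compactness, because images do not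
  commute with intersections. If \<open>x\<close> is not in the right-hand side, then the intersection
  lies in the open set of points that no \<open>f\<^sub>i\<close> sends to \<open>x\<close>; hence so does some \<open>H\<^sup>n(Q)\<close>,
  which keeps \<open>x\<close> out of \<open>H\<^sup>n\<^sup>+\<^sup>1(Q)\<close>.
\<close>

lemma H_invariant_Inter_iterates:
  fixes f :: "nat \<Rightarrow> 'a::metric_space \<Rightarrow> 'a"
  assumes "ifs m f" and "compact Q" and "forward_invariant m f Q"
  shows "H_invariant m f (\<Inter>n. (hutchinson m f ^^ n) Q)" (is "H_invariant m f ?G")
  unfolding H_invariant_def
proof
  show "hutchinson m f ?G \<subseteq> ?G"
  proof (rule INT_greatest)
    fix n
    have "hutchinson m f ?G \<subseteq> hutchinson m f ((hutchinson m f ^^ n) Q)"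
      by (intro monoD[OF mono_hutchinson]) blast
    also have "\<dots> = (hutchinson m f ^^ Suc n) Q" by simp
    also have "\<dots> \<subseteq> (hutchinson m f ^^ n) Q"
      using decseq_iterate_hutchinson[OF assms(3)] by (simp add: decseq_Suc_iff)
    finally show "hutchinson m f ?G \<subseteq> (hutchinson m f ^^ n) Q" .
  qed
  show "?G \<subseteq> hutchinson m f ?G"
  proof
    fix x assume "x \<in> ?G"
    show "x \<in> hutchinson m f ?G"
    proof (rule ccontr)
      assume x: "x \<notin> hutchinson m f ?G"
      define U where "U = (\<Inter>i\<in>{1..m}. f i -` (- {x}))"
      have "open U"
        unfolding U_def using assms(1) by (intro open_INT ballI open_vimage) (auto simp: ifs_def)
      moreover have "?G \<subseteq> U"
        using x unfolding U_def hutchinson_def by blast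
      ultimately obtain n where "(hutchinson m f ^^ n) Q \<subseteq> U"
        using decreasing_compact_eventually_subset[OF compact_iterate_hutchinson[OF assms(1,2)]
            decseq_iterate_hutchinson[OF assms(3)]] by metis
      then have "x \<notin> (hutchinson m f ^^ Suc n) Q"
        unfolding U_def by (auto simp: hutchinson_def)
      with \<open>x \<in> ?G\<close> show False by blast
    qed
  qed
qed

text \<open>
  A long word splits into an innermost part that moves \<open>K\<close> into \<open>Q\<close> and an outermost part of
  length \<open>n\<close>, which maps \<open>Q\<close> into \<open>H\<^sup>n(Q)\<close>. In terms of iterates, \<open>H\<^sup>n\<close> is applied to
  \<open>H\<^sup>k(K) \<subseteq> Q\<close>.
\<close>

lemma absorbs_iterate:
  assumes "absorbs m f Q K"
  shows "absorbs m f ((hutchinson m f ^^ n) Q) K"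
proof -
  obtain \<tau> where \<tau>: "\<tau> > 0" "\<forall>k\<ge>\<tau>. (hutchinson m f ^^ k) K \<subseteq> Q"
    using absorbs_imp_iterate_subset[OF assms] by (elim exE conjE)
  have "word_map f I ` K \<subseteq> (hutchinson m f ^^ n) Q"
    if "I \<in> words m" "length I \<ge> n + \<tau>" for I
  proof -
    define k where "k = length I - n"
    with that(2) have k: "length I = n + k" "k \<ge> \<tau>" by auto
    have "word_map f I ` K \<subseteq> (hutchinson m f ^^ n) ((hutchinson m f ^^ k) K)"
      using word_map_image_subset_iterate[OF that(1), of f K] by (simp add: k(1) funpow_add)
    also have "\<dots> \<subseteq> (hutchinson m f ^^ n) Q"
      using \<tau>(2) k(2) by (intro monoD[OF mono_pow[OF mono_hutchinson]]) simp
    finally show ?thesis .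
  qed
  then show ?thesis
    unfolding absorbs_def using \<tau>(1) by (intro exI[of _ "n + \<tau>"]) auto
qed

lemma global_attractor_Inter_iterates:
  fixes f :: "nat \<Rightarrow> 'a::metric_space \<Rightarrow> 'a"
  assumes "ifs m f" and "compact Q" and "global_trapping_region m f Q"
  shows "global_attractor m f (\<Inter>n. (hutchinson m f ^^ n) Q)" (is "global_attractor m f ?G")
proof -
  have inv: "forward_invariant m f Q" and Q_absorbs: "\<And>K. compact K \<Longrightarrow> absorbs m f Q K"
    using assms(3) by (auto simp: global_trapping_region_def trapping_region_def)
  \<comment> \<open>Any one-point set is a compact set that \<open>Q\<close> has to absorb.\<close>
  have "Q \<noteq> {}"
    using absorbing_set_nonempty[OF assms(1) Q_absorbs[of "{undefined}"]] by simp
  note comp = compact_iterate_hutchinson[OF assms(1,2)]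
  note enters = decreasing_compact_eventually_subset[OF comp decseq_iterate_hutchinson[OF inv]]
  have "?G \<noteq> {}"
    using enters[of "{}"] iterate_hutchinson_nonempty[OF assms(1) \<open>Q \<noteq> {}\<close>] by auto
  moreover have "compact ?G"
  proof -
    have "closed ?G" using comp by (auto intro: compact_imp_closed)
    moreover have "?G \<subseteq> (hutchinson m f ^^ 0) Q" by blast
    ultimately show ?thesis
      using compact_Int_closed[OF comp[of 0]] by (metis inf.absorb2)
  qed
  moreover have "attracts m f ?G K" if "compact K" for K
  proof -
    have "absorbs m f (nbhd \<epsilon> ?G) K" if pos: "\<epsilon> > 0" for \<epsilon>
    proof -
      obtain n where "(hutchinson m f ^^ n) Q \<subseteq> nbhd \<epsilon> ?G"
        using enters[OF open_nbhd subset_nbhd[OF pos]] by blast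
      with absorbs_iterate[OF Q_absorbs[OF \<open>compact K\<close>]] show ?thesis
        by (rule absorbs_mono)
    qed
    then show ?thesis unfolding attracts_def absorbs_def by blast
  qed
  ultimately show ?thesis
    unfolding global_attractor_def
    using H_invariant_Inter_iterates[OF assms(1,2) inv] by blast
qed

theorem theorem1:
  fixes f :: "nat \<Rightarrow> 'a::metric_space \<Rightarrow> 'a" and m :: nat
  assumes "locally_compact_space (euclidean :: 'a topology)"
    and "ifs m f"
  shows "compact_dynamics m f \<longleftrightarrow> (\<exists>Q. compact Q \<and> global_trapping_region m f Q)"
proof
  assume "compact_dynamics m f"
  then obtain G where "global_attractor m f G"
    by (auto simp: compact_dynamics_def)
  then show "\<exists>Q. compact Q \<and> global_trapping_region m f Q"
    by (rule global_attractor_imp_trapping_region[OF assms])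
next
  assume "\<exists>Q. compact Q \<and> global_trapping_region m f Q"
  then obtain Q where "compact Q" "global_trapping_region m f Q"
    by auto
  then show "compact_dynamics m f"
    using global_attractor_Inter_iterates[OF assms(2)] by (auto simp: compact_dynamics_def)
qed

end
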